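(* Let $G$ be a connected nontrivial graph with $m$ vertices and let $n\geq 2$. Then $$\lambda'(G\boxtimes P_n)=\min\{(3n-2)\lambda(G),\ m+2e(G),\ 2\xi(G)+4,\ 5\delta(G)+1\}.$$
   Context: All graphs are finite, simple and undirected; "nontrivial" means having at least two vertices. $P_n$, $C_n$, $K_n$ denote the path, cycle and complete graph on $n$ vertices. For a graph $G$: $e(G)=|E(G)|$; $\delta(G)$ is the minimum degree; $\lambda(G)$ is the edge-connectivity (minimum size of an edge set whose removal disconnects $G$); for an edge $uv$, its edge-degree is $d_G(u)+d_G(v)-2$, and $\xi(G)$ is the minimum edge-degree over all edges of $G$. A restricted edge-cut of a connected graph $G$ is a set $S\subseteq E(G)$ such that $G-S$ is disconnected and every component of $G-S$ has at least $2$ vertices; the restricted edge-connectivity $\lambda'(G)$ is the minimum cardinality of a restricted edge-cut (it exists, e.g., whenever $G$ has at least four vertices and is not a star, and then $\lambda'(G)\le\xi(G)$). The strong product $G\boxtimes H$ has vertex set $V(G)\times V(H)$, with $(x_1,y_1)$ and $(x_2,y_2)$ adjacent iff either $x_1=x_2$ and $y_1y_2\in E(H)$, or $y_1=y_2$ and $x_1x_2\in E(G)$, or $x_1x_2\in E(G)$ and $y_1y_2\in E(H)$. *)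

theory Defs
  imports Main
begin

type_synonym 'a graph = "'a set \<times> 'a set set"

definition verts :: "'a graph \<Rightarrow> 'a set" where "verts G = fst G"
definition edges :: "'a graph \<Rightarrow> 'a set set" where "edges G = snd G"

definition wf_graph :: "'a graph \<Rightarrow> bool" where
  "wf_graph G \<longleftrightarrow> finite (verts G) \<and>
     (\<forall>e\<in>edges G. \<exists>u v. e = {u, v} \<and> u \<noteq> v \<and> u \<in> verts G \<and> v \<in> verts G)"

definition adj :: "'a graph \<Rightarrow> 'a \<Rightarrow> 'a \<Rightarrow> bool" where
  "adj G u v \<longleftrightarrow> u \<noteq> v \<and> {u, v} \<in> edges G"

definition connected_graph :: "'a graph \<Rightarrow> bool" where
  "connected_graph G \<longleftrightarrow> verts G \<noteq> {} \<and>
     (\<forall>u\<in>verts G. \<forall>v\<in>verts G. (adj G)\<^sup>*\<^sup>* u v)"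

definition delete_edges :: "'a graph \<Rightarrow> 'a set set \<Rightarrow> 'a graph" where
  "delete_edges G S = (verts G, edges G - S)"

definition component :: "'a graph \<Rightarrow> 'a \<Rightarrow> 'a set" where
  "component G v = {u \<in> verts G. (adj G)\<^sup>*\<^sup>* v u}"

definition degree :: "'a graph \<Rightarrow> 'a \<Rightarrow> nat" where
  "degree G v = card {e \<in> edges G. v \<in> e}"

definition min_degree :: "'a graph \<Rightarrow> nat" where
  "min_degree G = Min (degree G ` verts G)"

definition min_edge_degree :: "'a graph \<Rightarrow> nat" where
  "min_edge_degree G =
     Min {degree G u + degree G v - 2 | u v. u \<noteq> v \<and> {u, v} \<in> edges G}"

definition edge_cut :: "'a graph \<Rightarrow> 'a set set \<Rightarrow> bool" where
  "edge_cut G S \<longleftrightarrow> S \<subseteq> edges G \<and> \<not> connected_graph (delete_edges G S)"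

definition edge_connectivity :: "'a graph \<Rightarrow> nat" where
  "edge_connectivity G = (LEAST k. \<exists>S. edge_cut G S \<and> card S = k)"

definition restricted_edge_cut :: "'a graph \<Rightarrow> 'a set set \<Rightarrow> bool" where
  "restricted_edge_cut G S \<longleftrightarrow> edge_cut G S \<and>
     (\<forall>v\<in>verts G. card (component (delete_edges G S) v) \<ge> 2)"

definition restricted_edge_connectivity :: "'a graph \<Rightarrow> nat" where
  "restricted_edge_connectivity G = (LEAST k. \<exists>S. restricted_edge_cut G S \<and> card S = k)"

definition path_graph :: "nat \<Rightarrow> nat graph" where
  "path_graph n = ({0..<n}, {{i, Suc i} | i. Suc i < n})"

definition strong_product :: "'a graph \<Rightarrow> 'b graph \<Rightarrow> ('a \<times> 'b) graph" where
  "strong_product G H = (verts G \<times> verts H,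
     {{(x1, y1), (x2, y2)} | x1 y1 x2 y2.
        x1 \<in> verts G \<and> x2 \<in> verts G \<and> y1 \<in> verts H \<and> y2 \<in> verts H \<and>
        ((x1 = x2 \<and> {y1, y2} \<in> edges H \<and> y1 \<noteq> y2) \<or>
         (y1 = y2 \<and> {x1, x2} \<in> edges G \<and> x1 \<noteq> x2) \<or>
         ({x1, x2} \<in> edges G \<and> x1 \<noteq> x2 \<and> {y1, y2} \<in> edges H \<and> y1 \<noteq> y2))})"

end

theory Submission
  imports Defs
begin

text \<open>
  The restricted edge-connectivity is the least boundary of a vertex set \<open>X\<close> such that neither \<open>X\<close>
  nor its complement induces an isolated vertex. In \<open>G \<boxtimes> P\<^sub>n\<close> such an \<open>X\<close> is a sequence of layers
  \<open>X\<^sub>0, \<dots>, X\<^sub>n\<^sub>-\<^sub>1\<close> of subsets of \<open>V(G)\<close>, and its boundary is the sum of the boundaries of the layers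
  in \<open>G\<close> and of the cuts \<open>c(X\<^sub>i, X\<^sub>i\<^sub>+\<^sub>1)\<close> between consecutive layers. If all layers are nonempty and
  proper, each boundary is at least \<open>\<lambda>\<close> and each \<open>c\<close> at least \<open>2\<lambda>\<close>, giving \<open>(3n - 2)\<lambda>\<close>. The cut \<open>c(A, B)\<close>
  is at least the difference of the weights \<open>\<Sum>x\<in>A. 1 + d(x)\<close> and \<open>\<Sum>x\<in>B. 1 + d(x)\<close>; hence an empty and a
  full layer together force \<open>m + 2e\<close>. Otherwise, up to complement, a nonempty layer is next to an
  empty one: if its other neighbour is nonempty, these layers contribute \<open>5\<delta> + 1\<close>, and if not, the
  layer contains an edge and contributes \<open>2\<xi> + 4\<close>. Conversely,
  explicit sets show that none of the four values is exceeded.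
\<close>

section \<open>Edge counts and cuts between layers\<close>

text \<open>Ordered pairs are counted, so an edge inside \<open>A \<inter> B\<close> counts twice.\<close>

definition edges_between :: "'a graph \<Rightarrow> 'a set \<Rightarrow> 'a set \<Rightarrow> nat" where
  "edges_between G A B = (\<Sum>x\<in>A. \<Sum>y\<in>B. of_bool (adj G x y))"

definition boundary :: "'a graph \<Rightarrow> 'a set \<Rightarrow> nat" where
  "boundary G A = edges_between G A (verts G - A)"

text \<open>If \<open>A\<close> and \<open>B\<close> are the parts of a vertex set in two
  consecutive layers of the product, this is the number of its boundary edges between those layers:
  the cardinalities count vertical edges, which join copies of one vertex, and the other two terms
  count diagonal edges.\<close>

definition layer_cut :: "'a graph \<Rightarrow> 'a set \<Rightarrow> 'a set \<Rightarrow> nat" where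
  "layer_cut G A B = card (A - B) + card (B - A)
     + edges_between G A (verts G - B) + edges_between G B (verts G - A)"

text \<open>Imposed on a set and on its complement, this makes every component left by the cut
  between them have at least two vertices.\<close>

definition no_isolated :: "'a graph \<Rightarrow> 'a set \<Rightarrow> bool" where
  "no_isolated G X \<longleftrightarrow> (\<forall>u\<in>X. \<exists>v\<in>X. adj G u v)"

lemma adj_sym: "adj G u v \<longleftrightarrow> adj G v u"
  by (auto simp: adj_def insert_commute)

lemma adj_irrefl [simp]: "\<not> adj G u u"
  by (simp add: adj_def)

lemma edges_between_commute: "edges_between G A B = edges_between G B A"
  unfolding edges_between_def by (subst sum.swap) (simp add: adj_sym)

lemma edges_between_empty [simp]:
  "edges_between G {} B = 0" "edges_between G A {} = 0"
  by (simp_all add: edges_between_def)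

lemma edges_between_Un_left:
  assumes "finite A" "finite B" "A \<inter> B = {}"
  shows "edges_between G (A \<union> B) C = edges_between G A C + edges_between G B C"
  using assms by (simp add: edges_between_def sum.union_disjoint)

lemma edges_between_Un_right:
  assumes "finite A" "finite B" "A \<inter> B = {}"
  shows "edges_between G C (A \<union> B) = edges_between G C A + edges_between G C B"
  using edges_between_Un_left[OF assms] by (simp add: edges_between_commute)

lemma edges_between_mono:
  assumes "A \<subseteq> A'" "B \<subseteq> B'" "finite A'" "finite B'"
  shows "edges_between G A B \<le> edges_between G A' B'"
proof -
  have "edges_between G A B \<le> (\<Sum>x\<in>A. \<Sum>y\<in>B'. of_bool (adj G x y))"
    unfolding edges_between_def using assms by (intro sum_mono sum_mono2) auto
  also have "\<dots> \<le> edges_between G A' B'"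
    unfolding edges_between_def using assms by (intro sum_mono2) auto
  finally show ?thesis .
qed

lemma edges_between_split:
  assumes "finite C" "D \<subseteq> C"
  shows "edges_between G A C = edges_between G A D + edges_between G A (C - D)"
proof -
  have "C = D \<union> (C - D)" using assms by blast
  then show ?thesis
    using edges_between_Un_right[of D "C - D" G A] assms finite_subset by fastforce
qed

lemma edges_between_singleton_le_card:
  assumes "finite B" shows "edges_between G {x} B \<le> card B"
proof -
  have "edges_between G {x} B \<le> (\<Sum>y\<in>B. 1)"
    unfolding edges_between_def by (simp add: sum_mono del: sum_constant sum_of_bool_eq)
  then show ?thesis by simp
qed

lemma edges_between_eq_sum:
  "edges_between G A B = (\<Sum>x\<in>A. edges_between G {x} B)"
  by (simp add: edges_between_def)

lemma edges_between_singleton_member_le: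
  assumes "finite A" "x \<in> A"
  shows "edges_between G {x} A \<le> card A - 1"
proof -
  have "edges_between G {x} A = edges_between G {x} {x} + edges_between G {x} (A - {x})"
    using assms by (intro edges_between_split) auto
  also have "edges_between G {x} {x} = 0" by (simp add: edges_between_def)
  also have "edges_between G {x} (A - {x}) \<le> card (A - {x})"
    using assms by (intro edges_between_singleton_le_card) auto
  finally show ?thesis using assms by simp
qed

lemma edges_between_self_le:
  assumes "finite A"
  shows "edges_between G A A \<le> card A * (card A - 1)"
proof -
  have "(\<Sum>x\<in>A. edges_between G {x} A) \<le> of_nat (card A) * (card A - 1)"
    using assms by (intro sum_bounded_above edges_between_singleton_member_le) auto
  then show ?thesis by (simp add: edges_between_eq_sum[of G A A])
qed

lemma edges_between_pos:
  assumes "finite A" "finite B" "x \<in> A" "y \<in> B" "adj G x y"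
  shows "edges_between G A B \<ge> 1"
proof -
  have "edges_between G {x} {y} \<le> edges_between G A B"
    using assms by (intro edges_between_mono) auto
  then show ?thesis using assms by (simp add: edges_between_def)
qed

lemma layer_cut_commute: "layer_cut G A B = layer_cut G B A"
  by (simp add: layer_cut_def)

text \<open>In a well-formed graph the second summand is the degree sum of \<open>A\<close>, so
  \<open>layer_cut G A {}\<close> is the weight of \<open>A\<close>; weights always appear in this
  form.\<close>

lemma layer_cut_empty: "layer_cut G A {} = card A + edges_between G A (verts G)"
  by (simp add: layer_cut_def)

lemma layer_cut_self: "layer_cut G A A = 2 * boundary G A"
  by (simp add: layer_cut_def boundary_def)

locale finite_simple_graph =
  fixes G :: "'a graph"
  assumes wf: "wf_graph G"
begin

abbreviation "V \<equiv> verts G"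
abbreviation "E \<equiv> edges_between G"
abbreviation "bd \<equiv> boundary G"
abbreviation "c \<equiv> layer_cut G"

lemma finite_V [simp, intro]: "finite V"
  using wf by (simp add: wf_graph_def)

lemma finite_subset_V: "A \<subseteq> V \<Longrightarrow> finite A"
  by (rule finite_subset) auto

lemma adj_in_V: "adj G u v \<Longrightarrow> u \<in> V \<and> v \<in> V"
  using wf unfolding wf_graph_def adj_def by (metis doubleton_eq_iff)

lemma finite_edges [simp, intro]: "finite (edges G)"
proof (rule finite_subset)
  show "edges G \<subseteq> Pow V" using wf unfolding wf_graph_def by auto
qed auto

lemma boundary_commute: "A \<subseteq> V \<Longrightarrow> bd (V - A) = bd A"
  by (simp add: boundary_def edges_between_commute double_diff)

lemma boundary_V [simp]: "bd V = 0" and boundary_empty [simp]: "bd {} = 0"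
  by (simp_all add: boundary_def)

text \<open>Passes from incident edges to neighbours: \<open>y \<mapsto> {v, y}\<close> maps the
  neighbours of \<open>v\<close> bijectively onto its incident edges.\<close>

lemma degree_eq_edges_between: "degree G v = E {v} V"
proof -
  have "{e \<in> edges G. v \<in> e} = (\<lambda>y. {v, y}) ` {y \<in> V. adj G v y}"
  proof (intro equalityI subsetI)
    fix e assume e: "e \<in> {e \<in> edges G. v \<in> e}"
    then obtain a b where "e = {a, b}" "a \<noteq> b" "a \<in> V" "b \<in> V"
      using wf unfolding wf_graph_def by blast
    with e show "e \<in> (\<lambda>y. {v, y}) ` {y \<in> V. adj G v y}"
      by (auto simp: adj_def insert_commute)
  qed (auto simp: adj_def)
  moreover have "inj_on (\<lambda>y. {v, y}) {y \<in> V. adj G v y}"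
    by (auto simp: inj_on_def doubleton_eq_iff)
  ultimately have "degree G v = card {y \<in> V. adj G v y}"
    by (simp add: degree_def card_image)
  also have "\<dots> = (\<Sum>y\<in>V. of_bool (adj G v y))"
    by (simp add: Int_def)
  finally show ?thesis by (simp add: edges_between_def)
qed

lemma edges_between_V:
  assumes "A \<subseteq> V"
  shows "E A V = bd A + E A A"
  using edges_between_split[of V A G A] assms by (simp add: boundary_def)

lemma handshake: "E V V = 2 * card (edges G)"
proof -
  have "E V V = (\<Sum>v\<in>V. card {e \<in> edges G. v \<in> e})"
    unfolding edges_between_eq_sum[of G V V] degree_eq_edges_between[symmetric] degree_def ..
  also have "\<dots> = (\<Sum>v\<in>V. \<Sum>e\<in>edges G. of_bool (v \<in> e))"
    by (simp add: Int_def)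
  also have "\<dots> = (\<Sum>e\<in>edges G. \<Sum>v\<in>V. of_bool (v \<in> e))"
    by (rule sum.swap)
  also have "\<dots> = (\<Sum>e\<in>edges G. 2)"
  proof (rule sum.cong)
    fix e assume "e \<in> edges G"
    then obtain a b where "e = {a, b}" "a \<noteq> b" "a \<in> V" "b \<in> V"
      using wf unfolding wf_graph_def by blast
    then have "V \<inter> e = {a, b}" "a \<noteq> b" by auto
    then show "(\<Sum>v\<in>V. of_bool (v \<in> e)) = (2::nat)" by simp
  qed simp
  finally show ?thesis by simp
qed

text \<open>Splitting \<open>A\<close>, \<open>B\<close> and their complements into the four cells of the Venn diagram makes every
  term nonnegative; the cross edges between \<open>A - B\<close> and \<open>B - A\<close> do not contribute.\<close>

lemma layer_cut_decomp:
  assumes "A \<subseteq> V" "B \<subseteq> V"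
  shows "c A B = card (A - B) + card (B - A) + E (A - B) (A - B) + E (B - A) (B - A)
    + bd (A \<inter> B) + bd (A \<union> B)"
proof -
  define s p q r where "s = A \<inter> B" and "p = B - A" and "q = A - B" and "r = V - (A \<union> B)"
  have fin [simp]: "finite s" "finite p" "finite q" "finite r"
    using assms finite_subset_V by (auto simp: s_def p_def q_def r_def)
  have dis [simp]: "s \<inter> p = {}" "s \<inter> q = {}" "s \<inter> r = {}" "p \<inter> q = {}" "p \<inter> r = {}" "q \<inter> r = {}"
    by (auto simp: s_def p_def q_def r_def)
  have eqs: "A = s \<union> q" "B = s \<union> p" "V - B = q \<union> r" "V - A = p \<union> r"
    "V - s = p \<union> (q \<union> r)"
    using assms by (auto simp: s_def p_def q_def r_def)
  have "bd (A \<union> B) = bd r"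
    using boundary_commute[of "A \<union> B"] assms by (simp add: r_def)
  also have "\<dots> = E r (s \<union> (p \<union> q))"
    unfolding boundary_def by (rule arg_cong[of _ _ "E r"]) (use assms in \<open>auto simp: s_def p_def q_def r_def\<close>)
  also have "\<dots> = E r s + (E r p + E r q)"
    by (simp add: edges_between_Un_right Int_Un_distrib)
  finally have r: "bd (A \<union> B) = E r s + (E r p + E r q)" .
  have s: "bd (A \<inter> B) = E s p + (E s q + E s r)"
    unfolding boundary_def s_def[symmetric] eqs(5)
    by (simp add: edges_between_Un_right Int_Un_distrib)
  have a: "E A (V - B) = E s q + E s r + (E q q + E q r)"
    unfolding eqs(3) by (subst eqs(1)) (simp add: edges_between_Un_right edges_between_Un_left)
  have b: "E B (V - A) = E s p + E s r + (E p p + E p r)"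
    unfolding eqs(4) by (subst eqs(2)) (simp add: edges_between_Un_right edges_between_Un_left)
  have "E r s = E s r" "E r p = E p r" "E r q = E q r" by (rule edges_between_commute)+
  then show ?thesis unfolding layer_cut_def a b r s p_def[symmetric] q_def[symmetric] by simp
qed

lemma layer_cut_complement:
  assumes "A \<subseteq> V" "B \<subseteq> V"
  shows "c (V - A) (V - B) = c A B"
proof -
  have "V - A - (V - B) = B - A" "V - B - (V - A) = A - B" "V - (V - A) = A" "V - (V - B) = B"
    using assms by auto
  then show ?thesis
    by (simp add: layer_cut_def edges_between_commute)
qed

text \<open>A triangle inequality for weights: pairs from \<open>A\<close> to \<open>V - B\<close>
  are paid for by the cut, and those counted by \<open>E A B\<close> form part of the degree sum of
  \<open>B\<close>.\<close>

lemma weight_le_layer_cut_add: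
  assumes "A \<subseteq> V" "B \<subseteq> V"
  shows "c A {} \<le> c A B + c B {}"
proof -
  have f: "finite A" "finite B" using assms finite_subset_V by auto
  have "card A \<le> card (A - B) + card B"
    using f card_Un_le[of "A - B" B] card_mono[of "(A - B) \<union> B" A] by fastforce
  moreover have "E A V = E A B + E A (V - B)"
    using assms by (intro edges_between_split) auto
  moreover have "E A B \<le> E B V"
    unfolding edges_between_commute[of G A B] using assms f by (intro edges_between_mono) auto
  ultimately show ?thesis by (simp add: layer_cut_def)
qed

end

section \<open>Lower bounds for boundaries and layer cuts in a connected graph\<close>

locale connected_simple_graph = finite_simple_graph +
  assumes conn: "connected_graph G" and nontrivial: "card V \<ge> 2"
begin

lemma boundary_pos:
  assumes "A \<subseteq> V" "A \<noteq> {}" "A \<noteq> V"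
  shows "bd A \<ge> 1"
proof -
  obtain u v where uv: "u \<in> A" "v \<in> V - A" using assms by auto
  have "(adj G)\<^sup>*\<^sup>* u v" using conn uv assms(1) unfolding connected_graph_def by blast
  \<comment> \<open>Invariant along a walk from \<open>u\<close>: it is still inside
    \<open>A\<close>, or an edge leaving \<open>A\<close> exists. At \<open>v\<close> the first
    alternative fails.\<close>
  then have "v \<in> A \<or> (\<exists>x\<in>A. \<exists>y\<in>V - A. adj G x y)"
  proof (induction rule: rtranclp_induct)
    case (step y z)
    then show ?case using adj_in_V by blast
  qed (use uv in auto)
  then obtain x y where "x \<in> A" "y \<in> V - A" "adj G x y" using uv by auto
  then show ?thesis unfolding boundary_def using assms finite_subset_V
    by (intro edges_between_pos) auto
qed

lemma singleton_proper: "x \<in> V \<Longrightarrow> {x} \<noteq> V"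
  using nontrivial by (metis One_nat_def card.empty card_insert_if empty_iff finite.emptyI not_less_eq_eq numeral_2_eq_2 order_refl)

abbreviation "\<delta> \<equiv> min_degree G"

lemma min_degree_le: "v \<in> V \<Longrightarrow> \<delta> \<le> E {v} V"
  unfolding min_degree_def degree_eq_edges_between[symmetric] by simp

lemma min_degree_attained: obtains v where "v \<in> V" "E {v} V = \<delta>"
proof -
  have "\<delta> \<in> degree G ` V"
    unfolding min_degree_def using conn by (intro Min_in) (auto simp: connected_graph_def)
  then show thesis using that degree_eq_edges_between by force
qed

lemma boundary_singleton: "x \<in> V \<Longrightarrow> bd {x} = E {x} V"
  using edges_between_V[of "{x}"] by (simp add: edges_between_def)

lemma min_degree_pos: "\<delta> \<ge> 1"
  by (metis boundary_pos boundary_singleton empty_not_insert empty_subsetI insert_subset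
      min_degree_attained singleton_proper)

lemma exists_neighbour:
  assumes "x \<in> V" shows "\<exists>y. adj G x y"
proof (rule ccontr)
  assume "\<nexists>y. adj G x y"
  then have "E {x} V = 0" by (simp add: edges_between_def)
  then show False using min_degree_le[OF assms] min_degree_pos by simp
qed

lemma card_mult_min_degree_le:
  assumes "A \<subseteq> V" shows "card A * \<delta> \<le> E A V"
proof -
  have "of_nat (card A) * \<delta> \<le> (\<Sum>x\<in>A. E {x} V)"
    using assms min_degree_le by (intro sum_bounded_below) auto
  then show ?thesis by (simp add: edges_between_eq_sum[of G A V])
qed

text \<open>A vertex of \<open>A\<close> has at most \<open>card A - 1\<close> neighbours inside
  \<open>A\<close>, so on average at least \<open>\<delta> + 1 - card A\<close> outside.\<close>

lemma small_boundary:
  assumes "A \<subseteq> V" "card A \<le> \<delta>"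
  shows "bd A \<ge> card A * (\<delta> + 1 - card A)"
proof -
  have "card A * \<delta> \<le> bd A + card A * (card A - 1)"
    using card_mult_min_degree_le[OF assms(1)] edges_between_V[OF assms(1)]
      edges_between_self_le[of A G] finite_subset_V[OF assms(1)] by simp
  moreover obtain t where "\<delta> = card A + t" using assms(2) le_Suc_ex by blast
  ultimately show ?thesis by (cases "card A") (auto simp: algebra_simps)
qed

text \<open>The expression \<open>a * (\<delta> + 1 - a)\<close> is concave in \<open>a\<close> and
  equals \<open>\<delta>\<close> at both ends \<open>a = 1\<close> and
  \<open>a = \<delta>\<close>.\<close>

lemma small_boundary_ge_min_degree:
  assumes "A \<subseteq> V" "A \<noteq> {}" "card A \<le> \<delta>"
  shows "bd A \<ge> \<delta>"
proof -
  have "card A \<ge> 1" using assms finite_subset_V by (simp add: Suc_le_eq card_gt_0_iff)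
  moreover obtain t where "\<delta> = card A + t" using assms(3) le_Suc_ex by blast
  ultimately have "card A * (\<delta> + 1 - card A) \<ge> \<delta>"
    by (cases "card A") auto
  then show ?thesis using small_boundary[OF assms(1,3)] by simp
qed

text \<open>Fix \<open>v\<close> in \<open>A\<close> and \<open>w\<close> in \<open>B\<close>.
  Neighbours of \<open>v\<close> in \<open>A\<close> are counted in \<open>E A A\<close>, those in
  \<open>B\<close> number at most \<open>card B\<close>, and the rest lie across
  \<open>bd (A \<union> B)\<close>; likewise for \<open>w\<close>. The terms of the cut thus pay for
  both degrees.\<close>

lemma layer_cut_disjoint:
  assumes "A \<subseteq> V" "B \<subseteq> V" "A \<noteq> {}" "B \<noteq> {}" "A \<inter> B = {}"
  shows "c A B \<ge> 2 * \<delta>"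
proof -
  have f: "finite A" "finite B" using assms finite_subset_V by auto
  obtain v w where vw: "v \<in> A" "w \<in> B" using assms by auto
  define r where "r = V - (A \<union> B)"
  have split: "E {x} V = E {x} A + E {x} B + E {x} r" for x
  proof -
    have "E {x} V = E {x} (A \<union> B) + E {x} r"
      unfolding r_def using assms by (intro edges_between_split) auto
    then show ?thesis using edges_between_Un_right[OF f assms(5)] by simp
  qed
  have "E {v} A \<le> E A A" "E {w} B \<le> E B B"
    using vw f by (auto intro!: edges_between_mono)
  moreover have "E {v} B \<le> card B" "E {w} A \<le> card A"
    using f by (auto intro: edges_between_singleton_le_card)
  moreover have "E {v} r + E {w} r \<le> bd (A \<union> B)"
  proof -
    have "E {v} r + E {w} r = E ({v} \<union> {w}) r"
      using vw assms(5) by (intro edges_between_Un_left[symmetric]) auto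
    also have "\<dots> \<le> bd (A \<union> B)" unfolding boundary_def r_def using vw f
      by (intro edges_between_mono) auto
    finally show ?thesis .
  qed
  moreover have "c A B = card A + card B + E A A + E B B + bd (A \<union> B)"
    using layer_cut_decomp[OF assms(1,2)] assms(5) by (simp add: Diff_triv Int_commute)
  moreover have "\<delta> \<le> E {v} V" "\<delta> \<le> E {w} V" using vw assms by (auto intro: min_degree_le)
  ultimately show ?thesis using split[of v] split[of w] by linarith
qed

lemma layer_cut_covering:
  assumes "A \<subseteq> V" "B \<subseteq> V" "A \<noteq> V" "B \<noteq> V" "A \<union> B = V"
  shows "c A B \<ge> 2 * \<delta>"
  using layer_cut_disjoint[of "V - A" "V - B"] layer_cut_complement[of A B] assms by auto

text \<open>Uncrossing: if \<open>A \<inter> B\<close> is nonempty and \<open>A \<union> B\<close>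
  is not \<open>V\<close>, their boundaries contribute \<open>l\<close> each; otherwise the cut is
  at least \<open>2 * \<delta>\<close>, and a singleton of minimum degree shows
  \<open>l \<le> \<delta>\<close>. Leaving \<open>l\<close> open allows both 1 and the
  edge-connectivity.\<close>

lemma layer_cut_ge:
  assumes "A \<subseteq> V" "B \<subseteq> V" "A \<noteq> {}" "B \<noteq> {}" "A \<noteq> V" "B \<noteq> V"
    and l: "\<And>S. S \<subseteq> V \<Longrightarrow> S \<noteq> {} \<Longrightarrow> S \<noteq> V \<Longrightarrow> l \<le> bd S"
  shows "c A B \<ge> 2 * l"
proof -
  obtain v where v: "v \<in> V" "E {v} V = \<delta>" by (rule min_degree_attained)
  then have "l \<le> \<delta>" using l[of "{v}"] boundary_singleton singleton_proper by force
  moreover have "c A B \<ge> 2 * l" if "A \<inter> B \<noteq> {}" "A \<union> B \<noteq> V"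
  proof -
    have "l \<le> bd (A \<inter> B)" "l \<le> bd (A \<union> B)" using that assms by (auto intro!: l)
    then show ?thesis using layer_cut_decomp[OF assms(1,2)] by simp
  qed
  ultimately show ?thesis
    using layer_cut_disjoint[of A B] layer_cut_covering[of A B] assms
    by (meson le_trans mult_le_mono2)
qed

text \<open>Here \<open>B\<close> is a layer next to an empty one and \<open>A\<close> its other
  neighbour. A large \<open>B\<close> has enough weight, a medium one enough weight and boundary
  together, and a single vertex leaves \<open>3 * \<delta>\<close> to be found in
  \<open>bd A + c A B\<close>.\<close>

lemma two_layers_ge:
  assumes "A \<subseteq> V" "B \<subseteq> V" "A \<noteq> {}" "B \<noteq> {}" "A \<noteq> V" "B \<noteq> V"
  shows "bd A + bd B + c A B + c B {} \<ge> 5 * \<delta> + 1"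
proof -
  have f: "finite A" "finite B" using assms finite_subset_V by auto
  have k1: "card B \<ge> 1" using assms f by (simp add: Suc_le_eq card_gt_0_iff)
  have pos: "bd A \<ge> 1" "bd B \<ge> 1" using boundary_pos assms by blast+
  have c2: "c A B \<ge> 2" using layer_cut_ge[OF assms, of 1] boundary_pos by simp
  have top: "c B {} \<ge> card B * (\<delta> + 1)"
    using card_mult_min_degree_le[OF assms(2)] by (simp add: layer_cut_empty)
  consider "card B \<ge> \<delta> + 1" | "2 \<le> card B" "card B \<le> \<delta>" | "card B = 1"
    using k1 by linarith
  then show ?thesis
  proof cases
    case 1
    have "(\<delta> + 1) * (\<delta> + 1) \<le> c B {}"
      using mult_le_mono1[OF 1, of "\<delta> + 1"] top by linarith
    \<comment> \<open>The 4 comes from \<open>bd A\<close>, \<open>bd B\<close> and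
      \<open>c A B\<close>, which are at least 1, 1 and 2. Four times the difference of the two
      sides is \<open>(2 * \<delta> - 3)^2 + 7\<close>.\<close>
    moreover have "5 * \<delta> + 1 \<le> (\<delta> + 1) * (\<delta> + 1) + 4"
    proof -
      have "0 \<le> (2 * int \<delta> - 3)\<^sup>2" by simp
      then have "int (5 * \<delta> + 1) \<le> int ((\<delta> + 1) * (\<delta> + 1) + 4)"
        by (simp add: power2_eq_square algebra_simps)
      then show ?thesis unfolding of_nat_le_iff .
    qed
    ultimately show ?thesis using pos c2 by linarith
  next
    case 2
    have "bd B \<ge> card B * (\<delta> + 1 - card B)" using small_boundary[OF assms(2)] 2 by simp
    \<comment> \<open>With \<open>b = card B\<close> the left side is
      \<open>b * (2 * \<delta> + 2 - b)\<close>, which increases for \<open>b \<le> \<delta>\<close>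
      and equals \<open>4 * \<delta>\<close> at \<open>b = 2\<close>.\<close>
    moreover have "card B * (\<delta> + 1) + card B * (\<delta> + 1 - card B) \<ge> 4 * \<delta>"
    proof -
      obtain a where a: "card B = a + 2" using 2 le_Suc_ex by (metis add.commute)
      obtain t where t: "\<delta> = card B + t" using 2 le_Suc_ex by blast
      show ?thesis unfolding t a by (simp add: algebra_simps)
    qed
    moreover have "bd A + c A B \<ge> \<delta> + 1"
    proof (cases "A \<inter> B = {} \<or> A \<union> B = V")
      case True
      then show ?thesis using layer_cut_disjoint[of A B] layer_cut_covering[of A B] assms pos by force
    next
      case False
      have "card (A \<inter> B) \<le> \<delta>" using 2(2) card_mono[of B "A \<inter> B"] f by simp
      then have "bd (A \<inter> B) \<ge> \<delta>" using False assms by (intro small_boundary_ge_min_degree) auto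
      moreover have "bd (A \<union> B) \<ge> 1" using False assms by (intro boundary_pos) auto
      ultimately show ?thesis using layer_cut_decomp[OF assms(1,2)] by simp
    qed
    ultimately show ?thesis using top by linarith
  next
    case 3
    then obtain x where B: "B = {x}" by (auto simp: card_1_singleton_iff)
    then have x: "x \<in> V" using assms by simp
    have "bd B + c B {} = 2 * E {x} V + 1"
      using boundary_singleton[OF x] by (simp add: B layer_cut_empty)
    moreover have "\<delta> \<le> E {x} V" using x by (rule min_degree_le)
    moreover have "bd A + c A B \<ge> 3 * \<delta>"
    proof (cases "bd A \<ge> \<delta>")
      case True
      have "c A B \<ge> 2 * \<delta>" if "x \<in> A"
      proof -
        have "A \<inter> B = B" "A \<union> B = A" using that B by auto
        then show ?thesis using layer_cut_decomp[OF assms(1,2)] True boundary_singleton[OF x]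
          min_degree_le[OF x] by (simp add: B)
      qed
      then show ?thesis using layer_cut_disjoint[of A B] True assms B by fastforce
    next
      case False
      \<comment> \<open>A small boundary forces \<open>A\<close> to have more than
        \<open>\<delta>\<close> vertices, so its degree sum is quadratic in \<open>\<delta>\<close>
        and makes up for the loss.\<close>
      then have big: "card A \<ge> \<delta> + 1" using small_boundary_ge_min_degree[of A] assms by linarith
      have sq: "2 * \<delta> \<le> \<delta> * \<delta> + 1"
      proof -
        have "0 \<le> (int \<delta> - 1)\<^sup>2" by simp
        then have "int (2 * \<delta>) \<le> int (\<delta> * \<delta> + 1)"
          by (simp add: power2_eq_square algebra_simps)
        then show ?thesis unfolding of_nat_le_iff .
      qed
      show ?thesis
      proof (cases "x \<in> A")
        case False
        then have "c A B \<ge> card A + E A A"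
          using layer_cut_decomp[OF assms(1,2)] B by simp
        moreover have "(\<delta> + 1) * \<delta> \<le> E A V"
          using mult_le_mono1[OF big, of \<delta>] card_mult_min_degree_le[OF assms(1)] by linarith
        ultimately show ?thesis using edges_between_V[OF assms(1)] big sq by simp
      next
        case True
        \<comment> \<open>Splitting off \<open>x\<close> shows that \<open>c A B\<close> is at least
          \<open>card A' + E A' V\<close>, hence at least
          \<open>\<delta> + \<delta> * \<delta>\<close>.\<close>
        define A' where "A' = A - {x}"
        have A': "A' \<subseteq> V" "finite A'" "A = A' \<union> {x}" "x \<notin> A'" using assms f True by (auto simp: A'_def)
        have "A - B = A'" "B - A = {}" "A \<inter> B = {x}" "A \<union> B = A" using True B by (auto simp: A'_def)
        then have "c A B = card A' + E A' A' + E {x} V + bd A"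
          using layer_cut_decomp[OF assms(1,2)] boundary_singleton[OF x] by (simp only: card.empty) simp
        moreover have "E A' V \<le> E A' A' + E {x} V + bd A"
        proof -
          have "E A' V = E A' A + E A' (V - A)" using assms by (intro edges_between_split) auto
          moreover have "E A' (V - A) \<le> bd A"
            unfolding boundary_def using A' f by (intro edges_between_mono) auto
          moreover have "E A' A = E A' A' + E A' {x}"
            using edges_between_Un_right[of A' "{x}" G A'] A' by simp
          moreover have "E A' {x} \<le> E {x} V"
            unfolding edges_between_commute[of G A'] using A' by (intro edges_between_mono) auto
          ultimately show ?thesis by linarith
        qed
        moreover have "card A' \<ge> \<delta>" using big A' by simp
        moreover have "\<delta> * \<delta> \<le> E A' V"
          using mult_le_mono1[OF \<open>card A' \<ge> \<delta>\<close>, of \<delta>] card_mult_min_degree_le[OF A'(1)] by linarith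
        ultimately show ?thesis using sq pos by linarith
      qed
    qed
    ultimately show ?thesis by linarith
  qed
qed

text \<open>For \<open>A = {x, y}\<close> both sides agree. Each further vertex takes at most 2 from
  the boundary edges at \<open>x\<close> and \<open>y\<close>, but returns 1 through
  \<open>card A\<close> and at least 1 through its own degree.\<close>

lemma one_layer_ge:
  assumes "A \<subseteq> V" "x \<in> A" "y \<in> A" "adj G x y"
  shows "bd A + c A {} \<ge> 2 * (degree G x + degree G y)"
proof -
  have f: "finite A" using assms finite_subset_V by auto
  have xy: "x \<noteq> y" using assms by auto
  define C where "C = A - {x, y}"
  have C: "finite C" "A = C \<union> {x, y}" "C \<inter> {x, y} = {}" "C \<subseteq> V" using f assms by (auto simp: C_def)
  have cardA: "card A = card C + 2"
    unfolding C(2) using C xy by (subst card_Un_disjoint) auto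
  have EA: "E A W = E C W + E {x} W + E {y} W" for W
    unfolding C(2) using C xy edges_between_Un_left[of "{x}" "{y}" G W]
    by (subst edges_between_Un_left) (auto simp: insert_commute)
  have "E {x} A \<le> card A - 1" "E {y} A \<le> card A - 1"
    using edges_between_singleton_member_le[OF f] assms by blast+
  moreover have "card C \<le> E C V"
    using card_mult_min_degree_le[OF C(4)] mult_le_mono2[OF min_degree_pos, of "card C"] by linarith
  moreover have "E {z} V = E {z} A + E {z} (V - A)" for z
    using assms by (intro edges_between_split) auto
  ultimately show ?thesis
    using EA[of V] EA[of "V - A"] cardA
    by (simp add: layer_cut_empty boundary_def degree_eq_edges_between)
qed

end

section \<open>Edge cuts and vertex sets\<close>

definition cut_edges :: "'a graph \<Rightarrow> 'a set \<Rightarrow> 'a set set" where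
  "cut_edges G X = {{x, y} | x y. x \<in> X \<and> y \<in> verts G - X \<and> adj G x y}"

lemma verts_delete_edges [simp]: "verts (delete_edges G S) = verts G"
  by (simp add: verts_def delete_edges_def)

lemma adj_delete_edges: "adj (delete_edges G S) u v \<longleftrightarrow> adj G u v \<and> {u, v} \<notin> S"
  by (auto simp: adj_def edges_def delete_edges_def)

lemma component_closed:
  assumes "adj (delete_edges G S) x y" "y \<in> verts G" "x \<in> component (delete_edges G S) u"
  shows "y \<in> component (delete_edges G S) u"
  using assms unfolding component_def by (auto intro: rtranclp.rtrancl_into_rtrancl)

lemma restricted_edge_cut_neighbour:
  assumes "restricted_edge_cut G S" "v \<in> verts G"
  shows "\<exists>w. adj (delete_edges G S) v w"
proof -
  have "card (component (delete_edges G S) v) \<ge> 2"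
    using assms by (simp add: restricted_edge_cut_def)
  then have "component (delete_edges G S) v \<noteq> {v}" by auto
  moreover have "v \<in> component (delete_edges G S) v"
    using assms by (simp add: component_def)
  ultimately obtain w where "(adj (delete_edges G S))\<^sup>*\<^sup>* v w" "w \<noteq> v"
    unfolding component_def by blast
  then show ?thesis by (metis converse_rtranclpE)
qed

context finite_simple_graph
begin

text \<open>A cut edge has exactly one end in \<open>X\<close>, so orienting it out of
  \<open>X\<close> matches unordered edges with the ordered pairs counted by
  \<open>bd\<close>.\<close>

lemma card_cut_edges:
  assumes "X \<subseteq> V"
  shows "card (cut_edges G X) = bd X"
proof -
  have f: "finite X" using assms by (rule finite_subset_V)
  have "inj_on (\<lambda>p. {fst p, snd p}) {p \<in> X \<times> (V - X). adj G (fst p) (snd p)}"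
    by (auto simp: inj_on_def doubleton_eq_iff)
  moreover have "cut_edges G X =
    (\<lambda>p. {fst p, snd p}) ` {p \<in> X \<times> (V - X). adj G (fst p) (snd p)}"
    (is "_ = ?f ` ?P")
  proof (intro equalityI subsetI)
    fix e assume "e \<in> cut_edges G X"
    then obtain x y where "e = {x, y}" "x \<in> X" "y \<in> V - X" "adj G x y"
      unfolding cut_edges_def mem_Collect_eq by (elim exE conjE)
    then show "e \<in> ?f ` ?P" by (intro image_eqI[of _ _ "(x, y)"]) simp_all
  next
    fix e assume "e \<in> ?f ` ?P"
    then obtain p where "e = ?f p" "p \<in> ?P" by (rule imageE)
    then show "e \<in> cut_edges G X"
      unfolding cut_edges_def by - (rule CollectI, rule exI[of _ "fst p"], rule exI[of _ "snd p"], auto)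
  qed
  ultimately have "card (cut_edges G X) = card {p \<in> X \<times> (V - X). adj G (fst p) (snd p)}"
    by (simp only: card_image)
  also have "\<dots> = (\<Sum>p\<in>X \<times> (V - X). of_bool (adj G (fst p) (snd p)))"
    using f by (simp add: Int_def)
  also have "\<dots> = bd X"
    unfolding boundary_def edges_between_def sum.cartesian_product by (rule sum.cong) auto
  finally show ?thesis .
qed

lemma cut_edges_subset: "cut_edges G X \<subseteq> edges G"
  by (auto simp: cut_edges_def adj_def)

lemma adj_delete_cut_edges:
  assumes "X \<subseteq> V"
  shows "adj (delete_edges G (cut_edges G X)) u v \<longleftrightarrow> adj G u v \<and> (u \<in> X \<longleftrightarrow> v \<in> X)"
proof -
  have "{u, v} \<in> cut_edges G X \<longleftrightarrow> (u \<in> X \<longleftrightarrow> v \<notin> X)" if "adj G u v"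
  proof -
    have "{u, v} \<in> cut_edges G X \<longleftrightarrow> (\<exists>x y. {u, v} = {x, y} \<and> x \<in> X \<and> y \<in> V - X \<and> adj G x y)"
      by (simp only: cut_edges_def mem_Collect_eq)
    also have "\<dots> \<longleftrightarrow> u \<in> X \<and> v \<in> V - X \<or> v \<in> X \<and> u \<in> V - X"
      unfolding doubleton_eq_iff using that adj_sym[of G u v] by blast
    finally show ?thesis using adj_in_V[OF that] by blast
  qed
  then show ?thesis by (auto simp: adj_delete_edges)
qed

lemma edge_cut_cut_edges:
  assumes "X \<subseteq> V" "X \<noteq> {}" "X \<noteq> V"
  shows "edge_cut G (cut_edges G X)"
proof -
  obtain u v where uv: "u \<in> X" "v \<in> V - X" using assms by auto
  have "v \<in> X" if "(adj (delete_edges G (cut_edges G X)))\<^sup>*\<^sup>* u v"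
    using that
    by (induction rule: rtranclp_induct) (use uv adj_delete_cut_edges[OF assms(1)] in auto)
  then show ?thesis
    using uv assms(1) cut_edges_subset unfolding edge_cut_def connected_graph_def by auto
qed

lemma edge_connectivity_le:
  assumes "X \<subseteq> V" "X \<noteq> {}" "X \<noteq> V"
  shows "edge_connectivity G \<le> bd X"
  unfolding edge_connectivity_def
  using edge_cut_cut_edges[OF assms] card_cut_edges[OF assms(1)] by (intro Least_le) auto

text \<open>Every edge leaving a component of the remaining graph was deleted, so the cut edges of
  that component lie in \<open>S\<close>. This replaces an arbitrary edge cut by a vertex set whose
  boundary is no larger.\<close>

lemma edge_cut_component:
  assumes "edge_cut G S" "V \<noteq> {}"
  obtains u where "u \<in> V" "component (delete_edges G S) u \<noteq> V"
    "bd (component (delete_edges G S) u) \<le> card S"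
proof -
  obtain u v where uv: "u \<in> V" "v \<in> V" "\<not> (adj (delete_edges G S))\<^sup>*\<^sup>* u v"
    using assms unfolding edge_cut_def connected_graph_def by auto
  let ?X = "component (delete_edges G S) u"
  have "?X \<noteq> V" using uv by (auto simp: component_def)
  moreover have "cut_edges G ?X \<subseteq> S"
  proof
    fix e assume "e \<in> cut_edges G ?X"
    then obtain x y where e: "e = {x, y}" "x \<in> ?X" "y \<in> V - ?X" "adj G x y"
      unfolding cut_edges_def mem_Collect_eq by (elim exE conjE)
    then have "\<not> adj (delete_edges G S) x y" using component_closed[of G S x y u] by blast
    then show "e \<in> S" using e by (simp add: adj_delete_edges)
  qed
  moreover have "finite S" "?X \<subseteq> V"
    using assms finite_subset[OF _ finite_edges] by (auto simp: edge_cut_def component_def)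
  ultimately have "?X \<noteq> V" "bd ?X \<le> card S"
    using card_mono[of S "cut_edges G ?X"] card_cut_edges[of ?X] by simp_all
  then show thesis by (rule that[OF uv(1)])
qed

lemma edge_connectivity_attained:
  assumes "card V \<ge> 2"
  obtains X where "X \<subseteq> V" "X \<noteq> {}" "X \<noteq> V" "bd X = edge_connectivity G"
proof -
  obtain v where v: "v \<in> V" using assms by (cases "V = {}") auto
  have "V \<noteq> {v}" using assms by auto
  then have "\<exists>k S. edge_cut G S \<and> card S = k" using v edge_cut_cut_edges[of "{v}"] by auto
  then obtain S where S: "edge_cut G S" "card S = edge_connectivity G"
    unfolding edge_connectivity_def using LeastI_ex[of "\<lambda>k. \<exists>S. edge_cut G S \<and> card S = k"] by blast
  obtain u where u: "u \<in> V" "component (delete_edges G S) u \<noteq> V"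
    "bd (component (delete_edges G S) u) \<le> card S"
    using edge_cut_component[OF S(1)] v by blast
  have X: "component (delete_edges G S) u \<subseteq> V" "u \<in> component (delete_edges G S) u"
    using u by (auto simp: component_def)
  then have "edge_connectivity G \<le> bd (component (delete_edges G S) u)"
    using u by (intro edge_connectivity_le) auto
  then have "bd (component (delete_edges G S) u) = edge_connectivity G" using u S by simp
  then show thesis using X u(2) by (intro that[of "component (delete_edges G S) u"]) blast+
qed

lemma restricted_edge_cut_cut_edges:
  assumes "X \<subseteq> V" "X \<noteq> {}" "X \<noteq> V" "no_isolated G X" "no_isolated G (V - X)"
  shows "restricted_edge_cut G (cut_edges G X)"
proof -
  have "card (component (delete_edges G (cut_edges G X)) v) \<ge> 2" if v: "v \<in> V" for v
  proof -
    obtain w where w: "adj G v w" "v \<in> X \<longleftrightarrow> w \<in> X"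
      using assms(4,5) v unfolding no_isolated_def by blast
    then have "adj (delete_edges G (cut_edges G X)) v w" "w \<in> V"
      using adj_in_V adj_delete_cut_edges[OF assms(1)] by blast+
    then have "{v, w} \<subseteq> component (delete_edges G (cut_edges G X)) v"
      using v by (simp add: component_def r_into_rtranclp)
    moreover have "finite (component (delete_edges G (cut_edges G X)) v)"
      by (simp add: component_def)
    moreover have "card {v, w} = 2" using w by (auto simp: adj_def)
    ultimately show ?thesis
      using card_mono[of "component (delete_edges G (cut_edges G X)) v" "{v, w}"] by linarith
  qed
  then show ?thesis using edge_cut_cut_edges[OF assms(1-3)] by (simp add: restricted_edge_cut_def)
qed

lemma restricted_edge_connectivity_le:
  assumes "X \<subseteq> V" "X \<noteq> {}" "X \<noteq> V" "no_isolated G X" "no_isolated G (V - X)"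
  shows "restricted_edge_connectivity G \<le> bd X"
  unfolding restricted_edge_connectivity_def
  using restricted_edge_cut_cut_edges[OF assms] card_cut_edges[OF assms(1)]
  by (intro Least_le) auto

text \<open>The fixed \<open>X\<close> supplies a restricted cut, without which the
  \<open>LEAST\<close> would be meaningless; the \<open>X\<close> in \<open>bound\<close> is a
  separate variable. A component left by a minimum restricted cut is then a set to which
  \<open>bound\<close> applies.\<close>

lemma restricted_edge_connectivity_ge:
  assumes "X \<subseteq> V" "X \<noteq> {}" "X \<noteq> V" "no_isolated G X" "no_isolated G (V - X)"
    and bound: "\<And>X. X \<subseteq> V \<Longrightarrow> X \<noteq> {} \<Longrightarrow> X \<noteq> V \<Longrightarrow> no_isolated G X
      \<Longrightarrow> no_isolated G (V - X) \<Longrightarrow> k \<le> bd X"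
  shows "k \<le> restricted_edge_connectivity G"
proof -
  have "\<exists>k S. restricted_edge_cut G S \<and> card S = k"
    using restricted_edge_cut_cut_edges[OF assms(1-5)] by blast
  then obtain S where S: "restricted_edge_cut G S" "card S = restricted_edge_connectivity G"
    unfolding restricted_edge_connectivity_def
    using LeastI_ex[of "\<lambda>k. \<exists>S. restricted_edge_cut G S \<and> card S = k"] by blast
  have "edge_cut G S" "V \<noteq> {}" using S assms by (auto simp: restricted_edge_cut_def)
  then obtain u where u: "u \<in> V" "component (delete_edges G S) u \<noteq> V"
    "bd (component (delete_edges G S) u) \<le> card S"
    using edge_cut_component by blast
  let ?X = "component (delete_edges G S) u"
  have X: "?X \<subseteq> V" "u \<in> ?X" using u by (auto simp: component_def)
  \<comment> \<open>Some edge at \<open>v\<close> survives the deletion of \<open>S\<close>, and its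
    other end lies on the same side of \<open>?X\<close>; hence neither side has an isolated
    vertex.\<close>
  have nb: "\<exists>w\<in>V. adj G v w \<and> (w \<in> ?X \<longleftrightarrow> v \<in> ?X)" if v: "v \<in> V" for v
  proof -
    obtain w where w: "adj (delete_edges G S) v w"
      using restricted_edge_cut_neighbour[OF S(1) v] by blast
    then have "adj G v w" "w \<in> V" using adj_in_V by (auto simp: adj_delete_edges)
    moreover have "w \<in> ?X \<longleftrightarrow> v \<in> ?X"
      using component_closed[of G S v w u] component_closed[of G S w v u] w v \<open>w \<in> V\<close>
        adj_sym[of "delete_edges G S" v w] by blast
    ultimately show ?thesis by blast
  qed
  have "k \<le> bd ?X" using X u nb by (intro bound) (auto simp: no_isolated_def)
  then show ?thesis using u S by simp
qed

end

section \<open>Boundaries in the strong product with a path\<close>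

text \<open>Edges of a product with a path join equal or consecutive layers, so a count indexed by
  pairs of layers is tridiagonal. The two off-diagonal terms for each \<open>i\<close> are the two
  directions of one layer cut.\<close>

lemma sum_tridiagonal:
  fixes f :: "nat \<Rightarrow> nat \<Rightarrow> 'b::comm_monoid_add"
  assumes "\<And>i j. Suc i < j \<or> Suc j < i \<Longrightarrow> f i j = 0"
  shows "(\<Sum>i<Suc k. \<Sum>j<Suc k. f i j) =
    (\<Sum>i<Suc k. f i i) + (\<Sum>i<k. f i (Suc i) + f (Suc i) i)"
proof (induction k)
  case (Suc k)
  have z: "(\<Sum>i<k. f i (Suc k)) = 0" "(\<Sum>j<k. f (Suc k) j) = 0"
    using assms by (auto intro!: sum.neutral)
  have "(\<Sum>i<Suc (Suc k). \<Sum>j<Suc (Suc k). f i j) =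
    (\<Sum>i<Suc k. \<Sum>j<Suc k. f i j) + (\<Sum>i<Suc k. f i (Suc k)) + (\<Sum>j<Suc (Suc k). f (Suc k) j)"
    by (simp only: sum.lessThan_Suc[of _ "Suc k"] sum.distrib) (simp only: ac_simps)
  also have "\<dots> = (\<Sum>i<Suc k. \<Sum>j<Suc k. f i j) + f k (Suc k) + (f (Suc k) k + f (Suc k) (Suc k))"
    using z by simp
  finally show ?case unfolding Suc.IH by (simp add: ac_simps)
qed simp

definition layer :: "('a \<times> nat) set \<Rightarrow> nat \<Rightarrow> 'a set" where
  "layer X i = {x. (x, i) \<in> X}"

lemma verts_path [simp]: "verts (path_graph n) = {..<n}"
  by (auto simp: verts_def path_graph_def)

lemma verts_strong_product [simp]: "verts (strong_product G H) = verts G \<times> verts H"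
  by (simp add: verts_def strong_product_def)

lemma edges_strong_product: "edges (strong_product G H) =
    {{(x1, y1), (x2, y2)} | x1 y1 x2 y2.
        x1 \<in> verts G \<and> x2 \<in> verts G \<and> y1 \<in> verts H \<and> y2 \<in> verts H \<and>
        ((x1 = x2 \<and> {y1, y2} \<in> edges H \<and> y1 \<noteq> y2) \<or>
         (y1 = y2 \<and> {x1, x2} \<in> edges G \<and> x1 \<noteq> x2) \<or>
         ({x1, x2} \<in> edges G \<and> x1 \<noteq> x2 \<and> {y1, y2} \<in> edges H \<and> y1 \<noteq> y2))}"
  by (simp only: edges_def[of "strong_product G H"]) (simp only: strong_product_def snd_conv)

lemma edges_strong_productE:
  assumes "e \<in> edges (strong_product G H)"
  obtains x1 y1 x2 y2 where "e = {(x1, y1), (x2, y2)}" "x1 \<in> verts G" "x2 \<in> verts G"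
    "y1 \<in> verts H" "y2 \<in> verts H"
    "x1 = x2 \<and> {y1, y2} \<in> edges H \<and> y1 \<noteq> y2 \<or> y1 = y2 \<and> {x1, x2} \<in> edges G \<and> x1 \<noteq> x2 \<or>
     {x1, x2} \<in> edges G \<and> x1 \<noteq> x2 \<and> {y1, y2} \<in> edges H \<and> y1 \<noteq> y2"
  using assms unfolding edges_strong_product mem_Collect_eq by (elim exE conjE) (rule that)

lemma edges_path_iff: "{i, j} \<in> edges (path_graph n) \<longleftrightarrow>
    i < n \<and> j < n \<and> (j = Suc i \<or> i = Suc j)"
  by (auto simp: edges_def path_graph_def doubleton_eq_iff)

context finite_simple_graph
begin

lemma adj_strong_product_path:
  "adj (strong_product G (path_graph n)) (x, i) (y, j) \<longleftrightarrow>
     x \<in> V \<and> y \<in> V \<and> i < n \<and> j < n \<and>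
     (adj G x y \<and> i = j \<or> (x = y \<or> adj G x y) \<and> (j = Suc i \<or> i = Suc j))"
  (is "?L \<longleftrightarrow> ?R")
proof
  assume L: ?L
  then have "{(x, i), (y, j)} \<in> edges (strong_product G (path_graph n))"
    by (simp add: adj_def)
  then obtain x1 y1 x2 y2 where e: "{(x, i), (y, j)} = {(x1, y1), (x2, y2)}"
    and V: "x1 \<in> V" "x2 \<in> V" "y1 < n" "y2 < n"
    and "x1 = x2 \<and> {y1, y2} \<in> edges (path_graph n) \<and> y1 \<noteq> y2 \<or>
      y1 = y2 \<and> {x1, x2} \<in> edges G \<and> x1 \<noteq> x2 \<or>
      {x1, x2} \<in> edges G \<and> x1 \<noteq> x2 \<and> {y1, y2} \<in> edges (path_graph n) \<and> y1 \<noteq> y2"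
    by (rule edges_strong_productE) auto
  then have a: "x1 = x2 \<and> (y2 = Suc y1 \<or> y1 = Suc y2) \<or> y1 = y2 \<and> adj G x1 x2 \<or>
      adj G x1 x2 \<and> (y2 = Suc y1 \<or> y1 = Suc y2)"
    unfolding edges_path_iff adj_def by blast
  from e consider "x = x1" "i = y1" "y = x2" "j = y2" | "x = x2" "i = y2" "y = x1" "j = y1"
    by (auto simp: doubleton_eq_iff)
  then show ?R
  proof cases
    case 1
    then show ?thesis using V a by blast
  next
    case 2
    then show ?thesis using V a adj_sym[of G x1 x2] by blast
  qed
next
  assume R: ?R
  then have "{(x, i), (y, j)} \<in> edges (strong_product G (path_graph n))"
    unfolding edges_strong_product
    by - (rule CollectI, rule exI[of _ x], rule exI[of _ i], rule exI[of _ y], rule exI[of _ j],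
        auto simp: edges_path_iff adj_def)
  then show ?L using R by (auto simp: adj_def)
qed

lemma wf_strong_product_path: "wf_graph (strong_product G (path_graph n))"
proof -
  have "\<exists>u v. e = {u, v} \<and> u \<noteq> v \<and> u \<in> V \<times> {..<n} \<and> v \<in> V \<times> {..<n}"
    if "e \<in> edges (strong_product G (path_graph n))" for e
    using that
  proof (rule edges_strong_productE)
    fix x1 y1 x2 y2
    assume "e = {(x1, y1), (x2, y2)}" "x1 \<in> V" "x2 \<in> V"
      "y1 \<in> verts (path_graph n)" "y2 \<in> verts (path_graph n)"
      "x1 = x2 \<and> {y1, y2} \<in> edges (path_graph n) \<and> y1 \<noteq> y2 \<or>
        y1 = y2 \<and> {x1, x2} \<in> edges G \<and> x1 \<noteq> x2 \<or>
        {x1, x2} \<in> edges G \<and> x1 \<noteq> x2 \<and> {y1, y2} \<in> edges (path_graph n) \<and> y1 \<noteq> y2"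
    then show ?thesis
      by - (rule exI[of _ "(x1, y1)"], rule exI[of _ "(x2, y2)"], auto)
  qed
  then show ?thesis by (simp add: wf_graph_def)
qed

lemma boundary_strong_product_path:
  assumes "X \<subseteq> V \<times> {..<Suc k}"
  shows "boundary (strong_product G (path_graph (Suc k))) X =
    (\<Sum>i<Suc k. bd (layer X i)) + (\<Sum>i<k. c (layer X i) (layer X (Suc i)))"
proof -
  let ?H = "strong_product G (path_graph (Suc k))"
  \<comment> \<open>\<open>f i j\<close> counts boundary edges from the part of \<open>X\<close> in
    layer \<open>i\<close> to its complement in layer \<open>j\<close>. Keeping the conditions
    inside \<open>of_bool\<close> lets all sums run over fixed ranges, so they can be
    swapped.\<close>
  define f :: "nat \<Rightarrow> nat \<Rightarrow> nat" where "f i j =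
    (\<Sum>x\<in>V. \<Sum>y\<in>V. of_bool ((x, i) \<in> X \<and> (y, j) \<notin> X \<and> adj ?H (x, i) (y, j)))" for i j
  have LV: "layer X i \<subseteq> V" for i using assms by (auto simp: layer_def)
  have "boundary ?H X =
    (\<Sum>u\<in>V \<times> {..<Suc k}. \<Sum>v\<in>V \<times> {..<Suc k}. of_bool (u \<in> X \<and> v \<notin> X \<and> adj ?H u v))"
  proof -
    have "boundary ?H X = (\<Sum>u\<in>X. \<Sum>v\<in>V \<times> {..<Suc k}. of_bool (u \<in> X \<and> v \<notin> X \<and> adj ?H u v))"
      unfolding boundary_def edges_between_def
      by (intro sum.cong refl sum.mono_neutral_cong_left) auto
    also have "\<dots> = (\<Sum>u\<in>V \<times> {..<Suc k}. \<Sum>v\<in>V \<times> {..<Suc k}. of_bool (u \<in> X \<and> v \<notin> X \<and> adj ?H u v))"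
      using assms by (intro sum.mono_neutral_left) auto
    finally show ?thesis .
  qed
  also have "\<dots> = (\<Sum>x\<in>V. \<Sum>i<Suc k. \<Sum>y\<in>V. \<Sum>j<Suc k.
      of_bool ((x, i) \<in> X \<and> (y, j) \<notin> X \<and> adj ?H (x, i) (y, j)))"
    by (simp only: sum.cartesian_product')
  also have "\<dots> = (\<Sum>i<Suc k. \<Sum>x\<in>V. \<Sum>y\<in>V. \<Sum>j<Suc k.
      of_bool ((x, i) \<in> X \<and> (y, j) \<notin> X \<and> adj ?H (x, i) (y, j)))"
    by (rule sum.swap)
  also have "\<dots> = (\<Sum>i<Suc k. \<Sum>j<Suc k. f i j)"
  proof (rule sum.cong[OF refl])
    fix i
    have "(\<Sum>x\<in>V. \<Sum>y\<in>V. \<Sum>j<Suc k. of_bool ((x, i) \<in> X \<and> (y, j) \<notin> X \<and> adj ?H (x, i) (y, j))) =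
      (\<Sum>x\<in>V. \<Sum>j<Suc k. \<Sum>y\<in>V. of_bool ((x, i) \<in> X \<and> (y, j) \<notin> X \<and> adj ?H (x, i) (y, j)) :: nat)"
      by (intro sum.cong refl sum.swap)
    also have "\<dots> = (\<Sum>j<Suc k. f i j)" unfolding f_def by (rule sum.swap)
    finally show "(\<Sum>x\<in>V. \<Sum>y\<in>V. \<Sum>j<Suc k.
      of_bool ((x, i) \<in> X \<and> (y, j) \<notin> X \<and> adj ?H (x, i) (y, j))) = (\<Sum>j<Suc k. f i j)" .
  qed
  also have "\<dots> = (\<Sum>i<Suc k. f i i) + (\<Sum>i<k. f i (Suc i) + f (Suc i) i)"
    by (rule sum_tridiagonal) (auto simp: f_def adj_strong_product_path)
  also have "(\<Sum>i<Suc k. f i i) = (\<Sum>i<Suc k. bd (layer X i))"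
  proof (rule sum.cong[OF refl])
    fix i assume i: "i \<in> {..<Suc k}"
    have "bd (layer X i) =
      (\<Sum>x\<in>layer X i. \<Sum>y\<in>V. of_bool ((x, i) \<in> X \<and> (y, i) \<notin> X \<and> adj ?H (x, i) (y, i)))"
      unfolding boundary_def edges_between_def using i LV
      by (intro sum.cong refl sum.mono_neutral_cong_left)
        (auto simp: adj_strong_product_path layer_def)
    also have "\<dots> = f i i" unfolding f_def
      using LV by (intro sum.mono_neutral_left) (auto simp: layer_def)
    finally show "f i i = bd (layer X i)" by simp
  qed
  also have "(\<Sum>i<k. f i (Suc i) + f (Suc i) i) = (\<Sum>i<k. c (layer X i) (layer X (Suc i)))"
  proof (rule sum.cong[OF refl])
    fix i assume i: "i \<in> {..<k}"
    \<comment> \<open>Between consecutive layers, pairs with \<open>x = y\<close> are vertical edges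
      and the others diagonal; the two kinds exclude each other because \<open>adj G\<close> is
      irreflexive.\<close>
    have f: "f i j = card (layer X i - layer X j) + E (layer X i) (V - layer X j)"
      if ij: "i < Suc k" "j < Suc k" "j = Suc i \<or> i = Suc j" for i j
    proof -
      have "f i j = (\<Sum>x\<in>V. \<Sum>y\<in>V. of_bool (x \<in> layer X i \<and> y \<notin> layer X j \<and> x = y)
          + of_bool (x \<in> layer X i \<and> y \<notin> layer X j \<and> adj G x y))"
        unfolding f_def using ij
        by (intro sum.cong refl) (auto simp: adj_strong_product_path layer_def)
      also have "\<dots> = (\<Sum>x\<in>V. \<Sum>y\<in>V. of_bool (x \<in> layer X i \<and> y \<notin> layer X j \<and> x = y))
          + (\<Sum>x\<in>V. \<Sum>y\<in>V. of_bool (x \<in> layer X i \<and> y \<notin> layer X j \<and> adj G x y))"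
        by (simp only: sum.distrib)
      also have "(\<Sum>x\<in>V. \<Sum>y\<in>V. of_bool (x \<in> layer X i \<and> y \<notin> layer X j \<and> x = y))
        = card (layer X i - layer X j)"
      proof -
        have "(\<Sum>y\<in>V. of_bool (x \<in> layer X i \<and> y \<notin> layer X j \<and> x = y)) =
          (of_bool (x \<in> layer X i - layer X j) :: nat)" if "x \<in> V" for x
          using that by (subst sum.remove[of V x]) (auto intro!: sum.neutral)
        then have "(\<Sum>x\<in>V. \<Sum>y\<in>V. of_bool (x \<in> layer X i \<and> y \<notin> layer X j \<and> x = y))
          = (\<Sum>x\<in>V. of_bool (x \<in> layer X i - layer X j) :: nat)" by (rule sum.cong[OF refl])
        also have "\<dots> = card (V \<inter> (layer X i - layer X j))"
          by (simp add: Int_def)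
        also have "V \<inter> (layer X i - layer X j) = layer X i - layer X j" using LV by auto
        finally show ?thesis .
      qed
      also have "(\<Sum>x\<in>V. \<Sum>y\<in>V. of_bool (x \<in> layer X i \<and> y \<notin> layer X j \<and> adj G x y))
        = E (layer X i) (V - layer X j)"
      proof -
        have "E (layer X i) (V - layer X j) =
          (\<Sum>x\<in>layer X i. \<Sum>y\<in>V. of_bool (x \<in> layer X i \<and> y \<notin> layer X j \<and> adj G x y))"
          unfolding edges_between_def
          by (intro sum.cong refl sum.mono_neutral_cong_left) auto
        also have "\<dots> = (\<Sum>x\<in>V. \<Sum>y\<in>V. of_bool (x \<in> layer X i \<and> y \<notin> layer X j \<and> adj G x y))"
          using LV by (intro sum.mono_neutral_left) auto
        finally show ?thesis by simp
      qed
      finally show ?thesis .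
    qed
    show "f i (Suc i) + f (Suc i) i = c (layer X i) (layer X (Suc i))"
      using i by (simp add: f layer_cut_def)
  qed
  finally show ?thesis .
qed

end

section \<open>Weights along the sequence of layers, and the minimum edge-degree\<close>

context finite_simple_graph
begin

text \<open>Each step changes the weight by at most one layer cut. Both directions are stated
  because the heavier layer may be at either end.\<close>

lemma weight_telescope:
  assumes "i \<le> j" "\<And>t. L t \<subseteq> V"
  shows "c (L i) {} \<le> c (L j) {} + (\<Sum>t=i..<j. c (L t) (L (Suc t)))"
    and "c (L j) {} \<le> c (L i) {} + (\<Sum>t=i..<j. c (L t) (L (Suc t)))"
  using assms(1)
proof (induction j rule: dec_induct)
  case (step j)
  note bounds = weight_le_layer_cut_add[of "L j" "L (Suc j)"]
    weight_le_layer_cut_add[of "L (Suc j)" "L j"]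
  case 1 show ?case using step bounds assms(2) by simp
  case 2 show ?case using step bounds assms(2) layer_cut_commute[of G "L (Suc j)" "L j"] by simp
qed auto

text \<open>The weight varies from 0 at the empty layer to that of \<open>V\<close> at the full one,
  which \<open>handshake\<close> evaluates.\<close>

lemma full_and_empty_layer:
  assumes "\<And>t. L t \<subseteq> V" "i \<le> k" "j \<le> k" "L i = {}" "L j = V"
  shows "card V + 2 * card (edges G) \<le> (\<Sum>t<k. c (L t) (L (Suc t)))"
proof -
  have w: "c V {} = card V + 2 * card (edges G)" "c {} {} = 0"
    by (simp_all add: layer_cut_empty handshake)
  have sub: "(\<Sum>t=a..<b. c (L t) (L (Suc t))) \<le> (\<Sum>t<k. c (L t) (L (Suc t)))" if "b \<le> k" for a b
    using that by (intro sum_mono2) auto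
  show ?thesis
  proof (cases "i \<le> j")
    case True
    then show ?thesis
      using weight_telescope(2)[of i j L] sub[OF assms(3), of i] assms w by force
  next
    case False
    then show ?thesis
      using weight_telescope(1)[of j i L] sub[OF assms(2), of j] assms w by force
  qed
qed

lemma min_edge_degree_set:
  "finite {degree G u + degree G v - 2 | u v. u \<noteq> v \<and> {u, v} \<in> edges G}"
proof (rule finite_subset)
  show "{degree G u + degree G v - 2 | u v. u \<noteq> v \<and> {u, v} \<in> edges G}
    \<subseteq> (\<lambda>(u, v). degree G u + degree G v - 2) ` (V \<times> V)"
    using adj_in_V by (fastforce simp: adj_def)
qed auto

lemma min_edge_degree_le:
  assumes "adj G u v" shows "min_edge_degree G \<le> degree G u + degree G v - 2"
  unfolding min_edge_degree_def using assms min_edge_degree_set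
  by (intro Min_le) (auto simp: adj_def)

end

text \<open>A discrete intermediate value principle: without a change between consecutive indices
  \<open>P\<close> would be constant.\<close>

lemma adjacent_change:
  fixes P :: "nat \<Rightarrow> bool"
  assumes "i \<le> k" "j \<le> k" "P i" "\<not> P j"
  shows "\<exists>t<k. P t \<noteq> P (Suc t)"
proof (rule ccontr)
  assume no: "\<not> ?thesis"
  have "P t = P 0" if "t \<le> k" for t
    using that
  proof (induction t)
    case (Suc t)
    then show ?case using no by auto
  qed simp
  then show False using assms by blast
qed

section \<open>Lower bound: sequences with proper, empty or full layers\<close>

context connected_simple_graph
begin

text \<open>There are \<open>k + 1\<close> layers and \<open>k\<close> gaps, and
  \<open>(k + 1) + 2 * k\<close> equals \<open>3 * Suc k - 2\<close>.\<close>

lemma proper_layers: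
  assumes "\<And>t. t \<le> k \<Longrightarrow> L t \<subseteq> V \<and> L t \<noteq> {} \<and> L t \<noteq> V"
  shows "(3 * Suc k - 2) * edge_connectivity G
    \<le> (\<Sum>t<Suc k. bd (L t)) + (\<Sum>t<k. c (L t) (L (Suc t)))"
proof -
  have "of_nat (card {..<Suc k}) * edge_connectivity G \<le> (\<Sum>t<Suc k. bd (L t))"
    using assms by (intro sum_bounded_below edge_connectivity_le) auto
  moreover have "of_nat (card {..<k}) * (2 * edge_connectivity G) \<le> (\<Sum>t<k. c (L t) (L (Suc t)))"
    using assms by (intro sum_bounded_below layer_cut_ge edge_connectivity_le) auto
  ultimately show ?thesis by (simp add: algebra_simps)
qed

lemma degree_pos: "v \<in> V \<Longrightarrow> degree G v \<ge> 1"
  using min_degree_le[of v] min_degree_pos by (simp add: degree_eq_edges_between)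

text \<open>Both degrees are positive, so the truncated subtraction in the edge-degree is exact; the
  form with \<open>+ 2\<close> records this.\<close>

lemma min_edge_degree_attained:
  obtains x y where "adj G x y" "degree G x + degree G y = min_edge_degree G + 2"
proof -
  obtain v where "v \<in> V" using min_degree_attained by blast
  then obtain w where "adj G v w" using exists_neighbour by blast
  then have "{degree G u + degree G v - 2 | u v. u \<noteq> v \<and> {u, v} \<in> edges G} \<noteq> {}"
    by (auto simp: adj_def)
  from Min_in[OF min_edge_degree_set this]
  obtain x y where xy: "adj G x y" "min_edge_degree G = degree G x + degree G y - 2"
    unfolding min_edge_degree_def adj_def by blast
  have "degree G x \<ge> 1" "degree G y \<ge> 1"
    using degree_pos adj_in_V[OF xy(1)] by auto
  then show thesis using that xy by simp
qed

text \<open>Some nonempty layer \<open>b\<close> is next to an empty layer \<open>a\<close>. If its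
  other neighbour is nonempty, \<open>two_layers_ge\<close> applies; otherwise
  \<open>one_layer_ge\<close> does.\<close>

lemma empty_layer_bound:
  assumes X: "X \<subseteq> V \<times> {..<Suc k}" "X \<noteq> {}"
    and iso: "no_isolated (strong_product G (path_graph (Suc k))) X"
    and empty: "i \<le> k" "layer X i = {}"
    and proper: "\<And>t. t \<le> k \<Longrightarrow> layer X t \<noteq> V"
  shows "min (2 * min_edge_degree G + 4) (5 * \<delta> + 1)
    \<le> (\<Sum>t<Suc k. bd (layer X t)) + (\<Sum>t<k. c (layer X t) (layer X (Suc t)))"
proof -
  define L where "L = layer X"
  have LV: "L t \<subseteq> V" for t using X by (auto simp: L_def layer_def)
  obtain j where j: "j \<le> k" "L j \<noteq> {}"
    using X by (force simp: L_def layer_def)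
  obtain s where s: "s < k" "(L s = {}) \<noteq> (L (Suc s) = {})"
    using adjacent_change[of i k j "\<lambda>t. L t = {}"] empty j by (auto simp: L_def)
  obtain a b where ab: "a \<le> k" "b \<le> k" "a = Suc b \<or> b = Suc a" "L a = {}" "L b \<noteq> {}"
  proof (cases "L s = {}")
    case True
    then show ?thesis using s by (intro that[of s "Suc s"]) auto
  next
    case False
    then show ?thesis using s by (intro that[of "Suc s" s]) auto
  qed
  \<comment> \<open>The cut between two consecutive layers is indexed by the lower one, whichever of
    \<open>u\<close> and \<open>v\<close> that is.\<close>
  have step: "c (L (min u v)) (L (Suc (min u v))) = c (L u) (L v)"
    if "u = Suc v \<or> v = Suc u" for u v
    using that layer_cut_commute[of G "L u" "L v"] by (auto simp: min_def)
  have cuts: "(\<Sum>t\<in>T. c (L t) (L (Suc t))) \<le> (\<Sum>t<k. c (L t) (L (Suc t)))" if "T \<subseteq> {..<k}" for T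
    using that by (intro sum_mono2) auto
  have bds: "(\<Sum>t\<in>T. bd (L t)) \<le> (\<Sum>t<Suc k. bd (L t))" if "T \<subseteq> {..<Suc k}" for T
    using that by (intro sum_mono2) auto
  show ?thesis
  proof (cases "\<exists>d\<le>k. (d = Suc b \<or> b = Suc d) \<and> L d \<noteq> {}")
    case True
    then obtain d where d: "d \<le> k" "d = Suc b \<or> b = Suc d" "L d \<noteq> {}" by blast
    \<comment> \<open>Layer \<open>d\<close> is nonempty and layer \<open>a\<close> empty, so they
      lie on opposite sides of \<open>b\<close>, and their cuts with \<open>b\<close> are distinct
      terms of the sum.\<close>
    then have ne: "min a b \<noteq> min d b" "d \<noteq> b" using ab by (auto simp: min_def split: if_splits)
    have "c (L d) (L b) + c (L b) {} = (\<Sum>t\<in>{min d b, min a b}. c (L t) (L (Suc t)))"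
      using ne(1) step[OF d(2)] step[OF ab(3)] ab(4) layer_cut_commute[of G "{}" "L b"] by simp
    also have "\<dots> \<le> (\<Sum>t<k. c (L t) (L (Suc t)))"
      using d ab by (intro cuts) auto
    finally have "c (L d) (L b) + c (L b) {} \<le> (\<Sum>t<k. c (L t) (L (Suc t)))" .
    moreover have "bd (L d) + bd (L b) \<le> (\<Sum>t<Suc k. bd (L t))"
      using bds[of "{d, b}"] ne(2) d ab by auto
    moreover have "5 * \<delta> + 1 \<le> bd (L d) + bd (L b) + c (L d) (L b) + c (L b) {}"
      using LV d ab proper by (intro two_layers_ge) (auto simp: L_def)
    ultimately show ?thesis by (simp add: L_def)
  next
    case False
    obtain x where x: "(x, b) \<in> X" using ab by (auto simp: L_def layer_def)
    \<comment> \<open>All layers next to \<open>b\<close> are empty, so the neighbour of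
      \<open>(x, b)\<close> in \<open>X\<close> must lie in layer \<open>b\<close> and gives an edge
      of \<open>G\<close> inside \<open>L b\<close>.\<close>
    then obtain y e where ye: "(y, e) \<in> X"
      "adj (strong_product G (path_graph (Suc k))) (x, b) (y, e)"
      using iso unfolding no_isolated_def by force
    then have "e \<le> k" "L e \<noteq> {}"
      "adj G x y \<and> b = e \<or> (x = y \<or> adj G x y) \<and> (e = Suc b \<or> b = Suc e)"
      by (auto simp: adj_strong_product_path L_def layer_def)
    then have "e = b" "adj G x y" using False by blast+
    moreover from this have "x \<in> L b" "y \<in> L b" using x ye by (auto simp: L_def layer_def)
    ultimately have one: "2 * (degree G x + degree G y) \<le> bd (L b) + c (L b) {}"
      using LV by (intro one_layer_ge) auto
    have "2 * min_edge_degree G + 4 \<le> 2 * (degree G x + degree G y)"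
      using degree_pos[of x] degree_pos[of y] adj_in_V[OF \<open>adj G x y\<close>]
        min_edge_degree_le[OF \<open>adj G x y\<close>] by auto
    also note one
    also have "bd (L b) + c (L b) {}
      \<le> (\<Sum>t<Suc k. bd (L t)) + (\<Sum>t<k. c (L t) (L (Suc t)))"
    proof (rule add_mono)
      show "bd (L b) \<le> (\<Sum>t<Suc k. bd (L t))" using bds[of "{b}"] ab by auto
      show "c (L b) {} \<le> (\<Sum>t<k. c (L t) (L (Suc t)))"
        using cuts[of "{min a b}"] step[OF ab(3)] ab layer_cut_commute[of G "{}" "L b"] by auto
    qed
    finally show ?thesis unfolding L_def by (rule min.coboundedI1)
  qed
qed

lemma boundary_ge:
  assumes X: "X \<subseteq> V \<times> {..<Suc k}" "X \<noteq> {}" "X \<noteq> V \<times> {..<Suc k}"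
    and iso: "no_isolated (strong_product G (path_graph (Suc k))) X"
      "no_isolated (strong_product G (path_graph (Suc k))) (V \<times> {..<Suc k} - X)"
  shows "min (min ((3 * Suc k - 2) * edge_connectivity G) (card V + 2 * card (edges G)))
      (min (2 * min_edge_degree G + 4) (5 * \<delta> + 1))
    \<le> boundary (strong_product G (path_graph (Suc k))) X"
    (is "?M \<le> boundary ?H X")
proof -
  interpret H: finite_simple_graph ?H
    by unfold_locales (rule wf_strong_product_path)
  let ?Y = "V \<times> {..<Suc k} - X"
  have LV: "layer X t \<subseteq> V" for t using X by (auto simp: layer_def)
  have compl: "layer ?Y t = V - layer X t" if "t \<le> k" for t
    using that by (auto simp: layer_def)
  note bX = boundary_strong_product_path[OF X(1)]
  consider "\<And>t. t \<le> k \<Longrightarrow> layer X t \<noteq> {} \<and> layer X t \<noteq> V"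
    | i j where "i \<le> k" "j \<le> k" "layer X i = {}" "layer X j = V"
    | i where "i \<le> k" "layer X i = {}" "\<And>t. t \<le> k \<Longrightarrow> layer X t \<noteq> V"
    | i where "i \<le> k" "layer X i = V" "\<And>t. t \<le> k \<Longrightarrow> layer X t \<noteq> {}"
    by metis
  then show ?thesis
  proof cases
    case 1
    then show ?thesis using proper_layers[of k "layer X"] LV bX by simp
  next
    case 2
    then show ?thesis using full_and_empty_layer[of "layer X" i k j] LV bX by simp
  next
    case 3
    have "min (2 * min_edge_degree G + 4) (5 * \<delta> + 1) \<le> boundary ?H X"
      unfolding bX using 3 by (intro empty_layer_bound[OF X(1,2) iso(1)])
    then show ?thesis by (rule min.coboundedI2)
  next
    \<comment> \<open>With a full layer and no empty one, the complement has an empty layer, no full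
      one, and the same boundary.\<close>
    case 4
    have "layer ?Y i = {}" "\<And>t. t \<le> k \<Longrightarrow> layer ?Y t \<noteq> V"
      using 4 compl LV by (auto; blast)+
    moreover have Y: "?Y \<subseteq> V \<times> {..<Suc k}" "?Y \<noteq> {}" using X by auto
    ultimately have "min (2 * min_edge_degree G + 4) (5 * \<delta> + 1) \<le> boundary ?H ?Y"
      unfolding boundary_strong_product_path[OF Y(1)] using 4(1)
      by (intro empty_layer_bound[OF Y iso(2)])
    also have "boundary ?H ?Y = boundary ?H X"
      using H.boundary_commute[of X] X by simp
    finally show ?thesis by (rule min.coboundedI2)
  qed
qed

section \<open>Upper bounds: explicit sets in the product\<close>

lemma boundary_bottom_layer:
  assumes "A \<subseteq> V" "k \<ge> 1"
  shows "boundary (strong_product G (path_graph (Suc k))) (A \<times> {0}) = bd A + c A {}"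
proof -
  obtain k' where k: "k = Suc k'" using assms by (cases k) auto
  have "layer (A \<times> {0}) 0 = A" "layer (A \<times> {0}) (Suc t) = {}" for t
    by (auto simp: layer_def)
  moreover have "c {} {} = 0" by (simp add: layer_cut_empty)
  moreover have "A \<times> {0} \<subseteq> V \<times> {..<Suc k}" using assms by auto
  ultimately show ?thesis
    unfolding k by (subst boundary_strong_product_path)
      (simp_all add: sum.lessThan_Suc_shift del: sum.lessThan_Suc)
qed

text \<open>For a single vertex of minimum degree the terms are \<open>2 * \<delta>\<close>,
  \<open>2 * \<delta>\<close> and \<open>\<delta> + 1\<close>. The last one is the cut towards the
  third layer, which exists for \<open>k \<ge> 2\<close>.\<close>

lemma boundary_two_bottom_layers:
  assumes "A \<subseteq> V" "k \<ge> 2"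
  shows "boundary (strong_product G (path_graph (Suc k))) (A \<times> {0, 1})
    = 2 * bd A + c A A + c A {}"
proof -
  obtain k' where k: "k = Suc (Suc k')" using assms by (metis Suc_le_D numeral_2_eq_2 Suc_le_mono)
  have "layer (A \<times> {0, 1}) 0 = A" "layer (A \<times> {0, 1}) (Suc 0) = A"
    "layer (A \<times> {0, 1}) (Suc (Suc t)) = {}" for t
    by (auto simp: layer_def)
  moreover have "c {} {} = 0" by (simp add: layer_cut_empty)
  moreover have "A \<times> {0, 1} \<subseteq> V \<times> {..<Suc k}" using assms by auto
  ultimately show ?thesis
    unfolding k by (subst boundary_strong_product_path)
      (simp_all add: sum.lessThan_Suc_shift del: sum.lessThan_Suc)
qed

lemma boundary_cylinder:
  assumes "A \<subseteq> V"
  shows "boundary (strong_product G (path_graph (Suc k))) (A \<times> {..<Suc k})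
    = (3 * Suc k - 2) * bd A"
proof -
  have "layer (A \<times> {..<Suc k}) t = A" if "t < Suc k" for t
    using that by (auto simp: layer_def)
  then have "(\<Sum>t<Suc k. bd (layer (A \<times> {..<Suc k}) t)) = (\<Sum>t<Suc k. bd A)"
    "(\<Sum>t<k. c (layer (A \<times> {..<Suc k}) t) (layer (A \<times> {..<Suc k}) (Suc t))) = (\<Sum>t<k. c A A)"
    by (auto intro!: sum.cong simp del: sum.lessThan_Suc)
  moreover have "A \<times> {..<Suc k} \<subseteq> V \<times> {..<Suc k}" using assms by auto
  ultimately show ?thesis
    by (simp add: boundary_strong_product_path layer_cut_self algebra_simps del: sum.lessThan_Suc)
qed

lemma restricted_edge_connectivity_strong_product_le:
  assumes "X \<subseteq> V \<times> {..<Suc k}" "X \<noteq> {}" "X \<noteq> V \<times> {..<Suc k}"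
    and "no_isolated (strong_product G (path_graph (Suc k))) X"
    and "no_isolated (strong_product G (path_graph (Suc k))) (V \<times> {..<Suc k} - X)"
  shows "restricted_edge_connectivity (strong_product G (path_graph (Suc k)))
    \<le> boundary (strong_product G (path_graph (Suc k))) X"
proof -
  interpret H: finite_simple_graph "strong_product G (path_graph (Suc k))"
    by unfold_locales (rule wf_strong_product_path)
  show ?thesis using assms by (intro H.restricted_edge_connectivity_le) simp_all
qed

text \<open>The sets used below offer every vertex a neighbour in its own layer or directly above or
  below, so these two kinds are asked for.\<close>

lemma no_isolatedI:
  assumes "\<And>x i. (x, i) \<in> X \<Longrightarrow> x \<in> V \<and> i < n \<and>
     ((\<exists>y. adj G x y \<and> (y, i) \<in> X) \<or> (\<exists>j<n. (j = Suc i \<or> i = Suc j) \<and> (x, j) \<in> X))"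
  shows "no_isolated (strong_product G (path_graph n)) X"
  unfolding no_isolated_def
proof
  fix u assume u: "u \<in> X"
  obtain x i where ui: "u = (x, i)" by (cases u)
  with u assms[of x i]
  have xi: "x \<in> V" "i < n"
    and "(\<exists>y. adj G x y \<and> (y, i) \<in> X) \<or> (\<exists>j<n. (j = Suc i \<or> i = Suc j) \<and> (x, j) \<in> X)" by auto
  then consider y where "adj G x y" "(y, i) \<in> X"
    | j where "j < n" "j = Suc i \<or> i = Suc j" "(x, j) \<in> X" by blast
  then show "\<exists>v\<in>X. adj (strong_product G (path_graph n)) u v"
  proof cases
    case 1
    then show ?thesis using xi adj_in_V[OF 1(1)]
      by (intro bexI[of _ "(y, i)"]) (auto simp: ui adj_strong_product_path)
  next
    case 2
    then show ?thesis using xi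
      by (intro bexI[of _ "(x, j)"]) (auto simp: ui adj_strong_product_path)
  qed
qed

lemma no_isolated_cylinder:
  assumes "A \<subseteq> V" "k \<ge> 1"
  shows "no_isolated (strong_product G (path_graph (Suc k))) (A \<times> {..<Suc k})"
proof (rule no_isolatedI)
  fix x i assume xi: "(x, i) \<in> A \<times> {..<Suc k}"
  show "x \<in> V \<and> i < Suc k \<and> ((\<exists>y. adj G x y \<and> (y, i) \<in> A \<times> {..<Suc k}) \<or>
    (\<exists>j<Suc k. (j = Suc i \<or> i = Suc j) \<and> (x, j) \<in> A \<times> {..<Suc k}))"
  proof (cases i)
    case (Suc j)
    then have "j < Suc k" "(x, j) \<in> A \<times> {..<Suc k}" using xi by auto
    then show ?thesis using xi assms Suc by blast
  qed (use xi assms in auto)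
qed

text \<open>Bottom vertices outside \<open>A\<close> have their copy in layer 1; every higher layer
  is a whole copy of \<open>G\<close>, where no vertex is isolated.\<close>

lemma no_isolated_above_bottom_layer:
  assumes "A \<subseteq> V" "k \<ge> 1"
  shows "no_isolated (strong_product G (path_graph (Suc k))) (V \<times> {..<Suc k} - A \<times> {0})"
proof (rule no_isolatedI)
  fix x i assume xi: "(x, i) \<in> V \<times> {..<Suc k} - A \<times> {0}"
  then obtain y where "adj G x y" using exists_neighbour by blast
  then show "x \<in> V \<and> i < Suc k \<and> ((\<exists>y. adj G x y \<and> (y, i) \<in> V \<times> {..<Suc k} - A \<times> {0}) \<or>
    (\<exists>j<Suc k. (j = Suc i \<or> i = Suc j) \<and> (x, j) \<in> V \<times> {..<Suc k} - A \<times> {0}))"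
    using xi assms adj_in_V[of x y] by (cases i) auto
qed

text \<open>Applied to the ends of an edge of minimum edge-degree and to \<open>A = V\<close>. The
  bottom layer has a single neighbouring layer, so the weight of \<open>A\<close> is paid
  once.\<close>

lemma restricted_edge_connectivity_bottom_layer:
  assumes "A \<subseteq> V" "A \<noteq> {}" "k \<ge> 1" "\<And>x. x \<in> A \<Longrightarrow> \<exists>y\<in>A. adj G x y"
  shows "restricted_edge_connectivity (strong_product G (path_graph (Suc k))) \<le> bd A + c A {}"
proof -
  have "no_isolated (strong_product G (path_graph (Suc k))) (A \<times> {0})"
    by (rule no_isolatedI) (use assms in auto)
  moreover obtain x where "x \<in> A" using assms by auto
  then have "(x, 1) \<in> V \<times> {..<Suc k}" using assms by auto
  then have "A \<times> {0} \<noteq> V \<times> {..<Suc k}" by auto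
  ultimately show ?thesis
    using restricted_edge_connectivity_strong_product_le[of "A \<times> {0}" k] assms
      no_isolated_above_bottom_layer boundary_bottom_layer by auto
qed

lemma restricted_edge_connectivity_le_min_edge_degree:
  assumes "k \<ge> 1"
  shows "restricted_edge_connectivity (strong_product G (path_graph (Suc k)))
    \<le> 2 * min_edge_degree G + 4"
proof -
  obtain x y where xy: "adj G x y" "degree G x + degree G y = min_edge_degree G + 2"
    by (rule min_edge_degree_attained)
  then have V: "{x, y} \<subseteq> V" "x \<noteq> y" using adj_in_V by auto
  have "E {x, y} {x, y} = 2" using xy(1) V adj_sym[of G x y] by (simp add: edges_between_def)
  moreover have "E {x, y} V = degree G x + degree G y"
    using V by (simp add: degree_eq_edges_between edges_between_eq_sum[of G "{x, y}"])
  \<comment> \<open>With \<open>D\<close> the degree sum of \<open>x\<close> and \<open>y\<close>,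
    the boundary is \<open>D - 2\<close> and the weight \<open>D + 2\<close>.\<close>
  ultimately have "bd {x, y} + c {x, y} {} = 2 * min_edge_degree G + 4"
    using edges_between_V[OF V(1)] xy V by (simp add: layer_cut_empty)
  moreover have "restricted_edge_connectivity (strong_product G (path_graph (Suc k)))
    \<le> bd {x, y} + c {x, y} {}"
    using xy(1) V assms adj_sym[of G x y] by (intro restricted_edge_connectivity_bottom_layer) auto
  ultimately show ?thesis by simp
qed

lemma restricted_edge_connectivity_le_edge_connectivity:
  assumes "k \<ge> 1"
  shows "restricted_edge_connectivity (strong_product G (path_graph (Suc k)))
    \<le> (3 * Suc k - 2) * edge_connectivity G"
proof -
  obtain A where A: "A \<subseteq> V" "A \<noteq> {}" "A \<noteq> V" "bd A = edge_connectivity G"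
    using edge_connectivity_attained[OF nontrivial] .
  have "V \<times> {..<Suc k} - A \<times> {..<Suc k} = (V - A) \<times> {..<Suc k}" by auto
  moreover have "A \<times> {..<Suc k} \<noteq> {}" "A \<times> {..<Suc k} \<noteq> V \<times> {..<Suc k}"
    using A by (auto simp: times_eq_iff)
  ultimately show ?thesis
    using restricted_edge_connectivity_strong_product_le[of "A \<times> {..<Suc k}" k]
      no_isolated_cylinder[of A k] no_isolated_cylinder[of "V - A" k] A assms
      boundary_cylinder[of A k] by auto
qed

text \<open>For \<open>n = 2\<close> the cut around \<open>{x} \<times> P\<^sub>2\<close> has only \<open>4 * \<delta>\<close> edges; there the cylinder bound
  \<open>4 * \<lambda>(G)\<close> is already strong enough.\<close>

lemma restricted_edge_connectivity_le_min_degree: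
  assumes "k \<ge> 1"
  shows "restricted_edge_connectivity (strong_product G (path_graph (Suc k))) \<le> 5 * \<delta> + 1"
proof -
  obtain v where v: "v \<in> V" "E {v} V = \<delta>" by (rule min_degree_attained)
  then have bd: "bd {v} = \<delta>" by (simp add: boundary_singleton)
  show ?thesis
  proof (cases "k = 1")
    case True
    have "edge_connectivity G \<le> \<delta>"
      using edge_connectivity_le[of "{v}"] v bd singleton_proper by auto
    then show ?thesis
      using restricted_edge_connectivity_le_edge_connectivity[OF assms] True by simp
  next
    case False
    then have k: "k \<ge> 2" using assms by simp
    let ?X = "{v} \<times> {0, 1::nat}"
    have "no_isolated (strong_product G (path_graph (Suc k))) ?X"
      by (rule no_isolatedI) (use v k in auto)
    moreover have "no_isolated (strong_product G (path_graph (Suc k))) (V \<times> {..<Suc k} - ?X)"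
    proof (rule no_isolatedI)
      fix x i assume xi: "(x, i) \<in> V \<times> {..<Suc k} - ?X"
      then obtain y where y: "adj G x y" using exists_neighbour by blast
      \<comment> \<open>In layers 0 and 1 the copy of \<open>x\<close> in the other of these two
        layers is a neighbour; from layer 2 on, \<open>y\<close> is one.\<close>
      have "i = 0 \<and> x \<noteq> v \<or> i = 1 \<and> x \<noteq> v \<or> i \<ge> 2" using xi by auto
      then show "x \<in> V \<and> i < Suc k \<and> ((\<exists>y. adj G x y \<and> (y, i) \<in> V \<times> {..<Suc k} - ?X) \<or>
        (\<exists>j<Suc k. (j = Suc i \<or> i = Suc j) \<and> (x, j) \<in> V \<times> {..<Suc k} - ?X))"
        using xi y adj_in_V[OF y] k by auto
    qed
    moreover have "(v, 2) \<in> V \<times> {..<Suc k}" using v k by auto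
    then have "?X \<noteq> V \<times> {..<Suc k}" by auto
    moreover have "?X \<subseteq> V \<times> {..<Suc k}" using v k by auto
    ultimately have "restricted_edge_connectivity (strong_product G (path_graph (Suc k)))
      \<le> boundary (strong_product G (path_graph (Suc k))) ?X"
      by (intro restricted_edge_connectivity_strong_product_le) auto
    also have "\<dots> = 5 * \<delta> + 1"
      using boundary_two_bottom_layers[of "{v}" k] v bd k by (simp add: layer_cut_self layer_cut_empty)
    finally show ?thesis .
  qed
qed

lemma restricted_edge_connectivity_le_size:
  assumes "k \<ge> 1"
  shows "restricted_edge_connectivity (strong_product G (path_graph (Suc k)))
    \<le> card V + 2 * card (edges G)"
proof -
  have "V \<noteq> {}" using nontrivial by auto
  moreover have "\<exists>y\<in>V. adj G x y" if "x \<in> V" for x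
    using exists_neighbour[OF that] adj_in_V by blast
  ultimately have "restricted_edge_connectivity (strong_product G (path_graph (Suc k))) \<le> bd V + c V {}"
    using assms by (intro restricted_edge_connectivity_bottom_layer) simp_all
  then show ?thesis by (simp add: layer_cut_empty handshake)
qed

lemma restricted_edge_connectivity_strong_product_ge:
  assumes "k \<ge> 1"
  shows "min (min ((3 * Suc k - 2) * edge_connectivity G) (card V + 2 * card (edges G)))
      (min (2 * min_edge_degree G + 4) (5 * \<delta> + 1))
    \<le> restricted_edge_connectivity (strong_product G (path_graph (Suc k)))"
proof -
  interpret H: finite_simple_graph "strong_product G (path_graph (Suc k))"
    by unfold_locales (rule wf_strong_product_path)
  obtain v where "v \<in> V" by (rule min_degree_attained)
  then have A: "{v} \<subseteq> V" "{v} \<noteq> V" using singleton_proper by auto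
  \<comment> \<open>The cylinder over one vertex witnesses that a restricted cut exists.\<close>
  let ?X = "{v} \<times> {..<Suc k}" and ?W = "V \<times> {..<Suc k}"
  have "?W - ?X = (V - {v}) \<times> {..<Suc k}" by auto
  then have iso: "no_isolated (strong_product G (path_graph (Suc k))) (?W - ?X)"
    using no_isolated_cylinder[of "V - {v}" k] assms by simp
  have sub: "?X \<subseteq> ?W" "?X \<noteq> {}" "?X \<noteq> ?W"
    using A by (auto simp: times_eq_iff)
  show ?thesis
  proof (rule H.restricted_edge_connectivity_ge[of ?X], unfold verts_strong_product verts_path)
    show "no_isolated (strong_product G (path_graph (Suc k))) ?X"
      by (rule no_isolated_cylinder[OF A(1) assms])
  qed (fact sub iso boundary_ge)+
qed

end

theorem theorem3p1:
  fixes G :: "'a graph" and n :: nat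
  assumes "wf_graph G" and "connected_graph G" and "card (verts G) \<ge> 2" and "n \<ge> 2"
  shows "restricted_edge_connectivity (strong_product G (path_graph n)) =
    min (min ((3 * n - 2) * edge_connectivity G) (card (verts G) + 2 * card (edges G)))
        (min (2 * min_edge_degree G + 4) (5 * min_degree G + 1))"
proof -
  interpret connected_simple_graph G
    using assms by unfold_locales
  \<comment> \<open>\<open>k\<close> is the number of gaps between consecutive layers.\<close>
  obtain k where k: "n = Suc k" "k \<ge> 1" using assms(4) by (cases n) auto
  show ?thesis
    unfolding k(1)
  proof (rule antisym)
    show "restricted_edge_connectivity (strong_product G (path_graph (Suc k))) \<le>
      min (min ((3 * Suc k - 2) * edge_connectivity G) (card (verts G) + 2 * card (edges G)))
        (min (2 * min_edge_degree G + 4) (5 * min_degree G + 1))"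
      using restricted_edge_connectivity_le_edge_connectivity[OF k(2)]
        restricted_edge_connectivity_le_size[OF k(2)]
        restricted_edge_connectivity_le_min_edge_degree[OF k(2)]
        restricted_edge_connectivity_le_min_degree[OF k(2)]
      by (intro min.boundedI)
  qed (rule restricted_edge_connectivity_strong_product_ge[OF k(2)])
qed

end
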